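(* Let $(b_n)_{n\ge1}$ be a sequence of complex numbers with $(b_n)\in GM(\beta^{\ast},2)$. If $n|b_n|\to0$ as $n\to\infty$, then the series $$\sum_{n=1}^{\infty}b_n\sin nx$$ converges uniformly in $x\in\mathbb{R}$.
   Context: $\mathbb{N}=\{1,2,3,\dots\}$ and $[x]$ denotes the integer part of $x$. Sequences $a=(a_n)_{n\ge 1}$ are sequences of complex numbers indexed by the positive integers. For $r\in\mathbb{N}$, the class $GM(\beta^{\ast},r)$ is the set of all complex sequences $a=(a_n)$ for which there exist a real number $c>1$ and a constant $K(a)$ (both may depend on the sequence $a$, but not on $m$) such that for all $m\in\mathbb{N}$ $$\sum_{n=m}^{2m-1}|a_n-a_{n+r}|\le K(a)\,\beta^{\ast}_m,\qquad \beta^{\ast}_m=\sum_{k=m}^{m+r-1}|a_k|+\sum_{k=[m/c]}^{[cm]}\frac{|a_k|}{k}.$$ In the last sum only indices $k\ge 1$ are taken (i.e. if $[m/c]=0$ the sum starts at $k=1$). Here the class is used with $r=2$. *)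

theory Defs
  imports "HOL-Analysis.Analysis"
begin

text \<open>
  A sequence indexed by the positive integers is a function on \<^typ>\<open>nat\<close> whose value at 0
  is never used. The lower bound \<open>max 1 \<dots>\<close> keeps the second sum within indices
  \<open>k \<ge> 1\<close> when the integer part of \<open>m / c\<close> is 0.
\<close>

definition beta_star :: "nat \<Rightarrow> real \<Rightarrow> (nat \<Rightarrow> complex) \<Rightarrow> nat \<Rightarrow> real" where
  "beta_star r c a m =
     (\<Sum>k = m..m + r - 1. norm (a k)) +
     (\<Sum>k = max 1 (nat \<lfloor>real m / c\<rfloor>)..nat \<lfloor>c * real m\<rfloor>. norm (a k) / real k)"

definition GM_beta_star :: "nat \<Rightarrow> (nat \<Rightarrow> complex) set" where
  "GM_beta_star r =
     {a. \<exists>c K :: real. c > 1 \<and>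
       (\<forall>m\<ge>1. (\<Sum>n = m..2 * m - 1. norm (a n - a (n + r))) \<le> K * beta_star r c a m)}"

end

theory Submission
  imports Defs
begin

text \<open>
  Since \<open>n |b\<^sub>n| \<rightarrow> 0\<close>, the class condition gives \<open>\<Sum>\<^bsub>m\<le>n<2m\<^esub> |b\<^sub>n - b\<^bsub>n+2\<^esub>| = o(1/m)\<close>, and summing over
  dyadic blocks \<open>\<Sum>\<^bsub>n\<ge>m\<^esub> |b\<^sub>n - b\<^bsub>n+2\<^esub>| = o(1/m)\<close>. Writing \<open>x = y + k\<pi>\<close> with \<open>|y| \<le> \<pi>/2\<close>
  only multiplies the coefficients by the signs \<open>cos (n k \<pi>)\<close>, which are 2-periodic in \<open>n\<close>, so one
  may assume \<open>|x| \<le> \<pi>/2\<close>. There the terms with \<open>n |x| \<le> 1\<close> are estimated by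
  \<open>|sin (n x)| \<le> n |x|\<close>, and the others by summation by parts with step two, based on
  \<open>2 sin x sin (n x) = cos ((n - 1) x) - cos ((n + 1) x)\<close> and \<open>|sin x| \<ge> |x| / 2\<close>.
\<close>

section \<open>Decay of the step-two variation under the class condition\<close>

lemma beta_star_nonneg: "0 \<le> beta_star r c a m"
  unfolding beta_star_def by (intro add_nonneg_nonneg sum_nonneg) auto

text \<open>Every index that occurs is at least \<open>M\<close>, so
  \<open>norm (a k) \<le> d / k\<close> throughout. The first sum has two terms of size at most
  \<open>d / m\<close>. The second has at most \<open>c * m\<close> terms, each at most
  \<open>d / k\<^sup>2\<close> with \<open>k \<ge> m / (2 * c)\<close>; this produces the
  \<open>4 * c ^ 3\<close>.\<close>

lemma beta_star_2_le:
  fixes a :: "nat \<Rightarrow> complex"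
  assumes c: "c > 1" and M: "M \<ge> 1" and d: "d \<ge> 0"
    and small: "\<And>k. k \<ge> M \<Longrightarrow> real k * norm (a k) \<le> d"
    and m: "real m \<ge> 2 * c * real M"
  shows "beta_star 2 c a m \<le> d * (2 + 4 * c ^ 3) / real m"
proof -
  have bd: "norm (a k) \<le> d / real k" if "k \<ge> M" for k
    using small[OF that] M that by (simp add: field_simps)
  have cM: "1 * real M \<le> c * real M" "c * 1 \<le> c * real M"
    using c M by (auto intro!: mult_right_mono mult_left_mono)
  have mM: "m \<ge> M" and mpos: "real m > 0" and m2c: "real m \<ge> 2 * c"
    using m cM c M by linarith+
  have set2: "{m..m + 2 - 1} = {m, Suc m}" by auto
  have s1: "(\<Sum>k = m..m + 2 - 1. norm (a k)) \<le> 2 * d / real m"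
  proof -
    have "norm (a (Suc m)) \<le> d / real (Suc m)" using bd[of "Suc m"] mM by simp
    also have "\<dots> \<le> d / real m" using mpos d by (intro divide_left_mono) auto
    finally show ?thesis unfolding set2 using bd[OF mM] by simp
  qed
  define l where "l = max 1 (nat \<lfloor>real m / c\<rfloor>)"
  \<comment> \<open>The floor loses at most 1, and \<open>m \<ge> 2 * c\<close> makes that loss at
    most half of \<open>m / c\<close>.\<close>
  have lge: "real l \<ge> real m / (2 * c)"
  proof -
    have "real l \<ge> real m / c - 1" unfolding l_def by linarith
    moreover have "real m / (2 * c) \<ge> 1" using m2c c by (simp add: field_simps)
    ultimately show ?thesis by (simp add: field_simps)
  qed
  have lM: "l \<ge> M"
  proof -
    have "real m / (2 * c) \<ge> real M" using m c by (simp add: field_simps)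
    then show ?thesis using lge by linarith
  qed
  have term_le: "norm (a k) / real k \<le> d * (4 * c\<^sup>2 / (real m)\<^sup>2)" if k: "k \<ge> l" for k
  proof -
    have rk: "real k \<ge> real m / (2 * c)" using lge k by linarith
    have pos: "real m / (2 * c) > 0" using mpos c by simp
    have "norm (a k) / real k \<le> d / real k / real k"
      using bd k lM by (intro divide_right_mono) auto
    also have "\<dots> = d / (real k)\<^sup>2" by (simp add: power2_eq_square)
    also have "\<dots> \<le> d / (real m / (2 * c))\<^sup>2"
      using rk pos d by (intro divide_left_mono power_mono mult_pos_pos zero_less_power) linarith+
    also have "\<dots> = d * (4 * c\<^sup>2 / (real m)\<^sup>2)"
      using c by (simp add: power_divide power_mult_distrib)
    finally show ?thesis .
  qed
  have card_le: "real (card {l..nat \<lfloor>c * real m\<rfloor>}) \<le> c * real m"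
  proof -
    have "card {l..nat \<lfloor>c * real m\<rfloor>} \<le> nat \<lfloor>c * real m\<rfloor>"
      unfolding l_def by auto
    moreover have "real (nat \<lfloor>c * real m\<rfloor>) \<le> c * real m" using c by simp
    ultimately show ?thesis by linarith
  qed
  have "(\<Sum>k = l..nat \<lfloor>c * real m\<rfloor>. norm (a k) / real k)
      \<le> real (card {l..nat \<lfloor>c * real m\<rfloor>}) * (d * (4 * c\<^sup>2 / (real m)\<^sup>2))"
    by (rule sum_bounded_above) (use term_le in auto)
  also have "\<dots> \<le> c * real m * (d * (4 * c\<^sup>2 / (real m)\<^sup>2))"
    by (intro mult_right_mono card_le) (use d in auto)
  also have "\<dots> = 4 * c ^ 3 * d / real m"
    using mpos by (simp add: field_simps power2_eq_square power3_eq_cube)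
  finally have s2: "(\<Sum>k = l..nat \<lfloor>c * real m\<rfloor>. norm (a k) / real k) \<le> 4 * c ^ 3 * d / real m" .
  have "beta_star 2 c a m \<le> 2 * d / real m + 4 * c ^ 3 * d / real m"
    unfolding beta_star_def l_def[symmetric] by (intro add_mono s1 s2)
  also have "\<dots> = d * (2 + 4 * c ^ 3) / real m"
    by (simp add: algebra_simps add_divide_distrib)
  finally show ?thesis .
qed

lemma GM_beta_star_2_dyadic_small:
  fixes b :: "nat \<Rightarrow> complex"
  assumes "b \<in> GM_beta_star 2" and lim: "(\<lambda>n. real n * norm (b n)) \<longlonglongrightarrow> 0" and e: "e > 0"
  obtains N where "N \<ge> 1"
    "\<And>n. n \<ge> N \<Longrightarrow> real n * norm (b n) \<le> e"
    "\<And>m. m \<ge> N \<Longrightarrow> (\<Sum>n = m..<2 * m. norm (b n - b (n + 2))) \<le> e / real m"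
proof -
  from assms(1) obtain c K where c: "c > 1"
    and K: "\<And>m. m \<ge> 1 \<Longrightarrow> (\<Sum>n = m..2 * m - 1. norm (b n - b (n + 2))) \<le> K * beta_star 2 c b m"
    unfolding GM_beta_star_def by auto
  \<comment> \<open>\<open>A\<close> collects all constants of the class condition and of
    \<open>beta_star_2_le\<close>. The sign of \<open>K\<close> is unknown, whence the absolute
    value; adding 1 forces \<open>A \<ge> 1\<close>, so that \<open>d = e / A\<close> is also at
    most \<open>e\<close> and serves the pointwise bound.\<close>
  define A where "A = (\<bar>K\<bar> + 1) * (2 + 4 * c ^ 3)"
  have A1: "A \<ge> 1"
  proof -
    have "1 * 1 \<le> (\<bar>K\<bar> + 1) * (2 + 4 * c ^ 3)" using c by (intro mult_mono) auto
    then show ?thesis by (simp add: A_def)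
  qed
  define d where "d = e / A"
  have d: "d > 0" "d \<le> e" using e A1 by (auto simp: d_def field_simps)
  from order_tendstoD(2)[OF lim d(1)] obtain M0 where
    M0: "\<And>n. n \<ge> M0 \<Longrightarrow> real n * norm (b n) < d"
    by (auto simp: eventually_sequentially)
  define M where "M = max 1 M0"
  have M: "M \<ge> 1" "\<And>n. n \<ge> M \<Longrightarrow> real n * norm (b n) \<le> d"
    using M0 by (auto simp: M_def less_imp_le)
  define N where "N = max M (nat \<lceil>2 * c * real M\<rceil>)"
  show thesis
  proof
    show "N \<ge> 1" using M by (simp add: N_def)
    show "real n * norm (b n) \<le> e" if "n \<ge> N" for n
      using M(2)[of n] that d by (simp add: N_def)
    fix m assume m: "m \<ge> N"
    have mpos: "m \<ge> 1" using m M by (simp add: N_def)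
    have "real m \<ge> 2 * c * real M" using m unfolding N_def by linarith
    then have bs: "beta_star 2 c b m \<le> d * (2 + 4 * c ^ 3) / real m"
      using c M d by (intro beta_star_2_le) auto
    have "{m..<2 * m} = {m..2 * m - 1}" using mpos by auto
    then have "(\<Sum>n = m..<2 * m. norm (b n - b (n + 2))) \<le> K * beta_star 2 c b m"
      using K[OF mpos] by simp
    also have "\<dots> \<le> (\<bar>K\<bar> + 1) * beta_star 2 c b m"
      by (intro mult_right_mono beta_star_nonneg) auto
    also have "\<dots> \<le> (\<bar>K\<bar> + 1) * (d * (2 + 4 * c ^ 3) / real m)"
      by (intro mult_left_mono bs) auto
    also have "\<dots> = d * A / real m" by (simp add: A_def)
    also have "\<dots> = e / real m" using A1 by (simp add: d_def)
    finally show "(\<Sum>n = m..<2 * m. norm (b n - b (n + 2))) \<le> e / real m" .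
  qed
qed

text \<open>The blocks starting at p, 2p, 4p, ... contribute at most e/p, e/(2p), e/(4p), ..., a
  geometric series with sum 2e/p. The induction carries its exact partial sums, since the bare bound
  2e/p would not reproduce itself.\<close>

lemma sum_dyadic_blocks_le:
  fixes f :: "nat \<Rightarrow> real"
  assumes f: "\<And>n. f n \<ge> 0" and N: "N \<ge> 1" "p \<ge> N" and e: "e \<ge> 0"
    and block: "\<And>m. m \<ge> N \<Longrightarrow> sum f {m..<2 * m} \<le> e / real m"
  shows "sum f {p..<q} \<le> 2 * e / real p"
proof -
  have ppos: "real p > 0" using N by simp
  have pow: "sum f {p..<2 ^ j * p} \<le> e / real p * (2 - 2 / 2 ^ j)" for j
  proof (induction j)
    case (Suc j)
    have le: "p \<le> 2 ^ j * p" "2 ^ j * p \<le> 2 ^ Suc j * p" by auto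
    have "sum f {p..<2 ^ Suc j * p} = sum f {p..<2 ^ j * p} + sum f {2 ^ j * p..<2 * (2 ^ j * p)}"
      using sum.atLeastLessThan_concat[OF le, of f] by (simp add: mult.assoc)
    also have "\<dots> \<le> e / real p * (2 - 2 / 2 ^ j) + e / real (2 ^ j * p)"
      using le N by (intro add_mono Suc.IH block) linarith
    also have "\<dots> = e / real p * (2 - 2 / 2 ^ Suc j)"
      using ppos by (simp add: field_simps)
    finally show ?case .
  qed simp
  \<comment> \<open>\<open>q\<close> doublings certainly cover \<open>{p..<q}\<close>; the bound
    does not depend on their number.\<close>
  have "q < 2 ^ q" by (rule less_exp)
  also have "2 ^ q \<le> 2 ^ q * p" using N by simp
  finally have "sum f {p..<q} \<le> sum f {p..<2 ^ q * p}"
    using f by (intro sum_mono2) auto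
  also have "\<dots> \<le> e / real p * (2 - 2 / 2 ^ q)" by (rule pow)
  also have "\<dots> \<le> e / real p * 2" using e by (intro mult_left_mono) auto
  finally show ?thesis by (simp add: mult.commute)
qed

section \<open>Estimates for blocks of a sine series with |x| at most pi/2\<close>

lemma abs_sin_ge_half:
  fixes x :: real
  assumes "\<bar>x\<bar> \<le> pi / 2"
  shows "\<bar>x\<bar> / 2 \<le> \<bar>sin x\<bar>"
proof -
  have conc: "concave_on {0..pi / 2} (sin :: real \<Rightarrow> real)"
    by (rule f''_le0_imp_concave[where f' = cos and f'' = "\<lambda>x. - sin x"])
      (auto intro!: derivative_eq_intros sin_ge_zero)
  define t where "t = 2 * \<bar>x\<bar> / pi"
  have t: "0 \<le> t" "t \<le> 1" using assms by (auto simp: t_def field_simps)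
  \<comment> \<open>By concavity the sine lies above its chord from 0 to pi/2, which is Jordan's
    inequality sin |x| \<ge> 2|x|/pi; then pi < 4 gives the rounder constant 1/2.\<close>
  have "(1 - t) * sin 0 + t * sin (pi / 2) \<le> sin ((1 - t) *\<^sub>R 0 + t *\<^sub>R (pi / 2))"
    by (rule concave_onD[OF conc]) (use t in auto)
  moreover have "t * (pi / 2) = \<bar>x\<bar>" by (simp add: t_def)
  ultimately have "t \<le> sin \<bar>x\<bar>" by simp
  moreover have "\<bar>x\<bar> / 2 \<le> t"
    using pi_less_4 mult_left_mono[of pi 4 "\<bar>x\<bar>"] by (simp add: t_def field_simps)
  moreover have "\<bar>sin x\<bar> = \<bar>sin \<bar>x\<bar>\<bar>" by (simp add: abs_if)
  ultimately show ?thesis by linarith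
qed

lemma sum_telescope_step_2:
  fixes f :: "nat \<Rightarrow> 'a::ab_group_add"
  assumes "p \<le> q"
  shows "(\<Sum>n = p..<q. f n - f (n + 2)) = f p + f (p + 1) - f q - f (q + 1)"
  using assms by (induction rule: dec_induct) (auto simp: algebra_simps)

lemma norm_sin_sum_by_parts_le:
  fixes a :: "nat \<Rightarrow> complex"
  assumes pq: "p \<le> q"
  shows "2 * \<bar>sin x\<bar> * norm (\<Sum>n = p..<q. a n * complex_of_real (sin (real n * x)))
    \<le> norm (a p) + norm (a (p + 1)) + norm (a q) + norm (a (q + 1))
      + (\<Sum>n = p..<q. norm (a n - a (n + 2)))"
proof -
  \<comment> \<open>The shift makes \<open>C n - C (n + 2)\<close> equal to 2 sin x sin(nx), so
    summation by parts meets exactly the differences \<open>a n - a (n + 2)\<close>. The subtraction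
    is done in the reals, so \<open>n = 0\<close> is not truncated.\<close>
  define C where "C n = complex_of_real (cos ((real n - 1) * x))" for n
  have nC: "norm (z * C n) \<le> norm z" for z n
    by (simp add: C_def norm_mult mult_left_le)
  have trig: "complex_of_real (2 * sin x) * complex_of_real (sin (real n * x)) = C n - C (n + 2)" for n
  proof -
    have "2 * sin x * sin (real n * x) = cos ((real n - 1) * x) - cos ((real (n + 2) - 1) * x)"
    proof -
      have "(real n - 1) * x = real n * x - x" "(real (n + 2) - 1) * x = real n * x + x"
        by (simp_all add: algebra_simps)
      then show ?thesis by (simp only: cos_diff cos_add) simp
    qed
    then show ?thesis unfolding C_def by (metis of_real_diff of_real_mult)
  qed
  have "complex_of_real (2 * sin x) * (\<Sum>n = p..<q. a n * complex_of_real (sin (real n * x)))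
      = (\<Sum>n = p..<q. a n * (complex_of_real (2 * sin x) * complex_of_real (sin (real n * x))))"
    by (simp add: sum_distrib_left mult_ac)
  also have "\<dots> = (\<Sum>n = p..<q. (a n * C n - a (n + 2) * C (n + 2)) - (a n - a (n + 2)) * C (n + 2))"
    unfolding trig by (intro sum.cong) (auto simp: algebra_simps)
  also have "\<dots> = (a p * C p + a (p + 1) * C (p + 1) - a q * C q - a (q + 1) * C (q + 1))
      - (\<Sum>n = p..<q. (a n - a (n + 2)) * C (n + 2))"
    using sum_telescope_step_2[OF pq, of "\<lambda>n. a n * C n"] by (simp only: sum_subtractf)
  also have "norm \<dots> \<le> norm (a p * C p) + norm (a (p + 1) * C (p + 1)) + norm (a q * C q)
      + norm (a (q + 1) * C (q + 1)) + norm (\<Sum>n = p..<q. (a n - a (n + 2)) * C (n + 2))"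
    by (intro norm_triangle_le_diff add_mono norm_triangle_le order_refl)
  also have "\<dots> \<le> norm (a p) + norm (a (p + 1)) + norm (a q) + norm (a (q + 1))
      + (\<Sum>n = p..<q. norm (a n - a (n + 2)))"
    by (intro add_mono nC sum_norm_le)
  finally show ?thesis by (simp add: norm_mult abs_mult)
qed

text \<open>Cutting the block near 1/|x|, the head costs at most \<open>e\<close> and the tail at
  most \<open>6 * e\<close>, neither depending on \<open>x\<close>.\<close>

lemma norm_sin_block_le:
  fixes a :: "nat \<Rightarrow> complex"
  assumes N: "N \<ge> 1" "p \<ge> N"
    and small: "\<And>n. n \<ge> N \<Longrightarrow> real n * norm (a n) \<le> e"
    and var: "\<And>p q. p \<ge> N \<Longrightarrow> (\<Sum>n = p..<q. norm (a n - a (n + 2))) \<le> 2 * e / real p"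
    and x: "\<bar>x\<bar> \<le> pi / 2"
  shows "norm (\<Sum>n = p..<q. a n * complex_of_real (sin (real n * x))) \<le> 7 * e"
proof -
  have "0 \<le> real N * norm (a N)" by simp
  also have "\<dots> \<le> e" using small by simp
  finally have e: "e \<ge> 0" .
  show ?thesis
  proof (cases "x = 0 \<or> q < p")
    case True
    then show ?thesis using e by auto
  next
    case False
    then have x0: "\<bar>x\<bar> > 0" and pq: "p \<le> q" by auto
    let ?S = "\<lambda>p q. \<Sum>n = p..<q. a n * complex_of_real (sin (real n * x))"
    define s where "s = nat \<lceil>1 / \<bar>x\<bar>\<rceil>"
    have s: "real s \<ge> 1 / \<bar>x\<bar>" "s \<ge> 1" "real (s - 1) < 1 / \<bar>x\<bar>"
      using x0 unfolding s_def by (auto simp: le_nat_iff Suc_le_eq) linarith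
    have low: "norm (?S p r) \<le> e" if r: "r \<le> s" for r
    proof -
      have "norm (?S p r) \<le> (\<Sum>n = p..<r. e * \<bar>x\<bar>)"
      proof (rule sum_norm_le)
        fix n assume n: "n \<in> {p..<r}"
        have "norm (a n * complex_of_real (sin (real n * x))) \<le> norm (a n) * \<bar>real n * x\<bar>"
          unfolding norm_mult by (intro mult_left_mono) (auto intro: abs_sin_x_le_abs_x)
        also have "\<dots> = real n * norm (a n) * \<bar>x\<bar>" by (simp add: abs_mult)
        also have "\<dots> \<le> e * \<bar>x\<bar>"
          using n N by (intro mult_right_mono small) auto
        finally show "norm (a n * complex_of_real (sin (real n * x))) \<le> e * \<bar>x\<bar>" .
      qed
      also have "\<dots> = real (r - p) * (e * \<bar>x\<bar>)" by simp
      also have "\<dots> \<le> 1 / \<bar>x\<bar> * (e * \<bar>x\<bar>)"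
      proof (intro mult_right_mono)
        \<comment> \<open>Since \<open>p \<ge> 1\<close>, the head has at most \<open>s - 1\<close>
          terms. This matters: \<open>s\<close> itself may exceed 1/|x|, while \<open>s - 1\<close>
          is below it.\<close>
        have "r - p \<le> s - 1" using r N by linarith
        then show "real (r - p) \<le> 1 / \<bar>x\<bar>" using s(3) by linarith
      qed (use e in auto)
      also have "\<dots> = e" using x0 by simp
      finally show ?thesis .
    qed
    \<comment> \<open>The 6 counts four boundary terms of size e/r and the variation 2e/r. Dividing
      by |x| is harmless because r|x| \<ge> 1.\<close>
    have high: "norm (?S r q) \<le> 6 * e" if r: "r \<ge> N" "r \<ge> s" "r \<le> q" for r
    proof -
      have rpos: "real r > 0" using r N by simp
      have bd: "norm (a n) \<le> e / real r" if "n \<ge> r" for n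
      proof -
        have "real r * norm (a n) \<le> real n * norm (a n)" using that by (intro mult_right_mono) auto
        also have "\<dots> \<le> e" using small that r by simp
        finally show ?thesis using rpos by (simp add: field_simps)
      qed
      have rx: "1 \<le> real r * \<bar>x\<bar>"
      proof -
        have "1 / \<bar>x\<bar> \<le> real r" using s(1) r by linarith
        then show ?thesis using x0 by (simp add: field_simps)
      qed
      have "\<bar>x\<bar> * norm (?S r q) \<le> 2 * \<bar>sin x\<bar> * norm (?S r q)"
        using abs_sin_ge_half[OF x] by (intro mult_right_mono) auto
      also have "\<dots> \<le> norm (a r) + norm (a (r + 1)) + norm (a q) + norm (a (q + 1))
        + (\<Sum>n = r..<q. norm (a n - a (n + 2)))"
        by (rule norm_sin_sum_by_parts_le[OF r(3)])
      also have "\<dots> \<le> e / real r + e / real r + e / real r + e / real r + 2 * e / real r"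
        using r by (intro add_mono bd var) auto
      also have "\<dots> = 6 * e / real r" by simp
      finally have "real r * \<bar>x\<bar> * norm (?S r q) \<le> 6 * e"
        using rpos by (simp add: field_simps)
      moreover have "1 * norm (?S r q) \<le> real r * \<bar>x\<bar> * norm (?S r q)"
        by (intro mult_right_mono rx) auto
      ultimately show ?thesis by linarith
    qed
    consider "q \<le> s" | "s \<le> p" | "p \<le> s" "s \<le> q" by linarith
    then show ?thesis
    proof cases
      case 1
      then show ?thesis using low[of q] e by simp
    next
      case 2
      then show ?thesis using high[of p] e N pq by simp
    next
      case 3
      have "?S p q = ?S p s + ?S s q"
        by (rule sum.atLeastLessThan_concat[OF 3, symmetric])
      also have "norm \<dots> \<le> e + 6 * e"
        using low[of s] high[of s] 3 N by (intro norm_triangle_le add_mono) auto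
      finally show ?thesis by simp
    qed
  qed
qed

section \<open>Uniform Cauchy criterion and reduction modulo pi\<close>

theorem theorem5:
  fixes b :: "nat \<Rightarrow> complex"
  assumes "b \<in> GM_beta_star 2"
    and "(\<lambda>n. real n * norm (b n)) \<longlonglongrightarrow> 0"
  shows "uniformly_convergent_on (UNIV :: real set)
           (\<lambda>N x. \<Sum>n = 1..N. b n * complex_of_real (sin (real n * x)))"
proof (rule Cauchy_uniformly_convergent, rule uniformly_Cauchy_onI')
  fix e :: real assume e: "e > 0"
  \<comment> \<open>Any \<open>d\<close> with \<open>7 * d < e\<close> would do; the block estimate
    loses a factor 7 and the Cauchy condition is strict.\<close>
  define d where "d = e / 8"
  have d: "d > 0" "7 * d < e" using e by (auto simp: d_def)
  obtain N where N: "N \<ge> 1"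
    and small: "\<And>n. n \<ge> N \<Longrightarrow> real n * norm (b n) \<le> d"
    and block: "\<And>m. m \<ge> N \<Longrightarrow> (\<Sum>n = m..<2 * m. norm (b n - b (n + 2))) \<le> d / real m"
    using GM_beta_star_2_dyadic_small[OF assms d(1)] by metis
  have var: "(\<Sum>n = p..<q. norm (b n - b (n + 2))) \<le> 2 * d / real p" if "p \<ge> N" for p q
    by (rule sum_dyadic_blocks_le[OF _ N that]) (use d block in auto)
  let ?S = "\<lambda>N x. \<Sum>n = 1..N. b n * complex_of_real (sin (real n * x))"
  have "dist (?S m x) (?S n x) < e" if mn: "m \<ge> N" "n > m" for x :: real and m n
  proof -
    define k where "k = round (x / pi)"
    define y where "y = x - of_int k * pi"
    have "\<bar>y\<bar> = pi * \<bar>of_int k - x / pi\<bar>"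
      by (simp add: y_def abs_if field_simps)
    also have "\<dots> \<le> pi * (1 / 2)"
      unfolding k_def by (intro mult_left_mono of_int_round_abs_le) auto
    finally have y: "\<bar>y\<bar> \<le> pi / 2" by simp
    \<comment> \<open>This is the sign (-1)^(jk), kept in the form in which the addition formula for
      sin(jy + jk pi) delivers it.\<close>
    define \<sigma> where "\<sigma> j = cos (of_int (int j * k) * pi)" for j
    have sin_k: "sin (of_int i * pi) = 0" for i :: int
      by (auto simp: sin_zero_iff_int2)
    have \<sigma>1: "\<bar>\<sigma> j\<bar> = 1" for j
      using sin_cos_squared_add[of "of_int (int j * k) * pi"]
      unfolding \<sigma>_def sin_k by (auto simp: power2_eq_1_iff)
    have \<sigma>2: "\<sigma> (j + 2) = \<sigma> j" for j
    proof -
      have "of_int (int (j + 2) * k) * pi = of_int (int j * k) * pi + of_int k * (2 * pi)"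
        by (simp add: algebra_simps)
      moreover have "cos (of_int k * (2 * pi)) = 1" "sin (of_int k * (2 * pi)) = 0"
        using cos_int_2pin[of k] sin_int_2pin[of k] by (simp_all add: mult.commute)
      ultimately show ?thesis unfolding \<sigma>_def
        by (simp only: cos_add mult_1_right mult_zero_right diff_zero)
    qed
    \<comment> \<open>The sequence \<open>a\<close> depends on \<open>x\<close>, but by the period 2
      of the signs it inherits both bounds of \<open>b\<close> with the same \<open>N\<close> and
      \<open>d\<close>. This is what makes the estimate uniform in \<open>x\<close>.\<close>
    define a where "a j = b j * complex_of_real (\<sigma> j)" for j
    have na: "norm (a j) = norm (b j)" "norm (a j - a (j + 2)) = norm (b j - b (j + 2))" for j
    proof -
      show "norm (a j) = norm (b j)" by (simp add: a_def norm_mult \<sigma>1)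
      have "a j - a (j + 2) = (b j - b (j + 2)) * complex_of_real (\<sigma> j)"
        unfolding a_def \<sigma>2 by (simp add: algebra_simps)
      then show "norm (a j - a (j + 2)) = norm (b j - b (j + 2))"
        by (simp add: norm_mult \<sigma>1)
    qed
    have ab: "b j * complex_of_real (sin (real j * x)) = a j * complex_of_real (sin (real j * y))" for j
    proof -
      have "real j * x = real j * y + of_int (int j * k) * pi"
        by (simp add: y_def algebra_simps)
      then have "sin (real j * x) = \<sigma> j * sin (real j * y)"
        unfolding \<sigma>_def by (simp only: sin_add sin_k) simp
      then show ?thesis by (simp add: a_def)
    qed
    have "norm (\<Sum>j = m + 1..<n + 1. a j * complex_of_real (sin (real j * y))) \<le> 7 * d"
      by (rule norm_sin_block_le[OF N _ _ _ y]) (unfold na, use mn small var in auto)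
    moreover have "?S n x - ?S m x = (\<Sum>j = m + 1..<n + 1. b j * complex_of_real (sin (real j * x)))"
    proof -
      have le: "1 \<le> m + 1" "m + 1 \<le> n + 1" using mn by auto
      show ?thesis
        using sum.atLeastLessThan_concat[OF le, of "\<lambda>j. b j * complex_of_real (sin (real j * x))"]
        by (simp add: atLeastLessThanSuc_atLeastAtMost algebra_simps)
    qed
    ultimately have "norm (?S n x - ?S m x) \<le> 7 * d" by (simp only: ab)
    also note d(2)
    finally show ?thesis by (simp only: dist_norm norm_minus_commute)
  qed
  then show "\<exists>M. \<forall>x\<in>UNIV. \<forall>m\<ge>M. \<forall>n>m. dist (?S m x) (?S n x) < e"
    by blast
qed

end
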